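(* For every $\epsilon>0$ there is a constant $c=c(\epsilon)>0$ such that every complete monotone simple cylindrical graph on $n$ vertices contains at least $c\,n^{1-\epsilon}$ pairwise disjoint edges.
   Context: Let $\mathcal C=S^1\times\mathbb R$, where $S^1$ is $[0,1]$ with $0$ and $1$ identified; each point $p$ has coordinates $(p_x,p_y)$ with $0\le p_x<1$, $p_y\in\mathbb R$. A cylindrical graph is a graph drawn on $\mathcal C$ with vertices as distinct points and edges as Jordan arcs joining their endpoints, with no overlapping edges and no edge passing through a vertex. It is simple if every two edges meet in at most one point, either a common endpoint or a proper crossing; complete if every pair of vertices is joined by an edge. A vertical line is a set $\{p: p_x=a\}$. A curve is $x$-monotone if every vertical line meets it in at most one point. A cylindrical graph is monotone if every edge is $x$-monotone and no two vertices have the same $x$-coordinate (vertices are assumed to have $x$-coordinate different from $0$). Two edges are disjoint if they have no point in common. *)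

theory Defs
  imports "HOL-Analysis.Analysis"
begin

text \<open>Points of the cylinder C = S^1 x R are represented by pairs (x,y) with 0 <= x < 1.\<close>
type_synonym pt = "real \<times> real"

definition cyl :: "pt set" where
  "cyl = {p. 0 \<le> fst p \<and> fst p < 1}"

definition cproj :: "pt \<Rightarrow> pt" where
  "cproj q = (frac (fst q), snd q)"

text \<open>A Jordan arc on C from u to v: the injective image of [0,1] under a continuous map into C.
  Continuous maps [0,1] -> C are exactly the compositions of cproj with continuous maps into R^2
  (path lifting), so we parametrise by lifts.\<close>
definition jordan_arc_cyl :: "pt set \<Rightarrow> pt \<Rightarrow> pt \<Rightarrow> bool" where
  "jordan_arc_cyl A u v \<longleftrightarrow>
     (\<exists>\<gamma> :: real \<Rightarrow> real \<times> real.
        continuous_on {0..1} \<gamma> \<and> inj_on (cproj \<circ> \<gamma>) {0..1} \<and>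
        A = (cproj \<circ> \<gamma>) ` {0..1} \<and> cproj (\<gamma> 0) = u \<and> cproj (\<gamma> 1) = v)"

definition x_monotone :: "pt set \<Rightarrow> bool" where
  "x_monotone A \<longleftrightarrow> (\<forall>a. \<forall>p\<in>A. \<forall>q\<in>A. fst p = a \<and> fst q = a \<longrightarrow> p = q)"

text \<open>Proper crossing of two x-monotone curves A, B at a point p: on one side of the vertical
  line through p (locally) A lies below B, on the other side A lies above B.\<close>
definition crosses_at :: "pt set \<Rightarrow> pt set \<Rightarrow> pt \<Rightarrow> bool" where
  "crosses_at A B p \<longleftrightarrow>
     (\<exists>\<delta>>0. \<forall>h. 0 < h \<and> h < \<delta> \<longrightarrow>
        (\<exists>a1\<in>A. \<exists>b1\<in>B. \<exists>a2\<in>A. \<exists>b2\<in>B.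
           fst a1 = frac (fst p - h) \<and> fst b1 = frac (fst p - h) \<and>
           fst a2 = frac (fst p + h) \<and> fst b2 = frac (fst p + h) \<and>
           ((snd a1 < snd b1 \<and> snd b2 < snd a2) \<or> (snd b1 < snd a1 \<and> snd a2 < snd b2))))"

definition cedges :: "pt set \<Rightarrow> pt set set" where
  "cedges V = {{u, v} | u v. u \<in> V \<and> v \<in> V \<and> u \<noteq> v}"

definition complete_cyl_graph :: "pt set \<Rightarrow> (pt set \<Rightarrow> pt set) \<Rightarrow> bool" where
  "complete_cyl_graph V E \<longleftrightarrow>
     finite V \<and> V \<subseteq> cyl \<and>
     (\<forall>u\<in>V. \<forall>v\<in>V. u \<noteq> v \<longrightarrow> jordan_arc_cyl (E {u, v}) u v \<and> E {u, v} \<inter> V = {u, v}) \<and>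
     (\<forall>e\<in>cedges V. \<forall>f\<in>cedges V. e \<noteq> f \<longrightarrow> \<not> (E e \<subseteq> E f))"

definition monotone_cyl_graph :: "pt set \<Rightarrow> (pt set \<Rightarrow> pt set) \<Rightarrow> bool" where
  "monotone_cyl_graph V E \<longleftrightarrow>
     (\<forall>e\<in>cedges V. x_monotone (E e)) \<and> inj_on fst V \<and> (\<forall>v\<in>V. fst v \<noteq> 0)"

text \<open>Simple: two distinct edges meet in at most one point, which is either a common endpoint
  or a proper crossing (crossing defined for x-monotone edges, the only case needed here).\<close>
definition simple_cyl_graph :: "pt set \<Rightarrow> (pt set \<Rightarrow> pt set) \<Rightarrow> bool" where
  "simple_cyl_graph V E \<longleftrightarrow>
     (\<forall>e\<in>cedges V. \<forall>f\<in>cedges V. e \<noteq> f \<longrightarrow>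
        E e \<inter> E f = {} \<or>
        (\<exists>p. E e \<inter> E f = {p} \<and> (p \<in> e \<inter> f \<or> (p \<notin> e \<union> f \<and> crosses_at (E e) (E f) p))))"

end

theory Submission
  imports Defs
begin

text \<open>Order the vertices by \<open>x\<close>-coordinate. An edge between \<open>x < y\<close> runs either directly over
  \<open>[x, y]\<close> or wraps around over \<open>[y, x + 1]\<close>. Wrapping is transitive, because otherwise a triangle
  would wind twice around the cylinder; so the wrapping pairs form a partial order of which the
  vertex order is a linear extension. For \<open>x1 < x2 < x3 < x4\<close> with \<open>x1x2\<close> and \<open>x3x4\<close> wrapping,
  the edges \<open>x1x3\<close> and \<open>x2x4\<close> are disjoint whenever both wrap or both are direct. Hence a chain of
  \<open>2m\<close> vertices yields the \<open>m\<close> disjoint edges joining its \<open>i\<close>-th to its \<open>(i + m)\<close>-th vertex. Two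
  chains, one to the left of the other, either merge after deleting \<open>d\<close> vertices from each, or carry
  \<open>d\<close> disjoint direct edges between them; and direct edges over disjoint intervals are disjoint.
  Bisecting the vertex sequence gives at least \<open>n / (2 log n + 5)\<close> disjoint edges.\<close>

subsection \<open>Chains and matchings in a partial order with a linear extension\<close>

text \<open>Compare the elements of \<open>Q\<close> from the top with those of \<open>R\<close>
  from the bottom, one by one, and stop at the first related pair. By then \<open>d\<close> elements
  of each chain have been passed. The remaining ones form a single chain; the passed ones are
  unrelated across the two chains and are matched in increasing order.\<close>

lemma merge_chains:
  fixes B :: "'a::linorder \<Rightarrow> 'a \<Rightarrow> bool"
  assumes fin: "finite Q" "finite R"
    and less: "\<And>x y. x \<in> Q \<Longrightarrow> y \<in> R \<Longrightarrow> x < y"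
    and trans: "\<And>x y z. \<lbrakk>x \<in> Q \<union> R; y \<in> Q \<union> R; z \<in> Q \<union> R; x < y; y < z; B x y; B y z\<rbrakk> \<Longrightarrow> B x z"
    and Q: "\<And>x y. \<lbrakk>x \<in> Q; y \<in> Q; x < y\<rbrakk> \<Longrightarrow> B x y"
    and R: "\<And>x y. \<lbrakk>x \<in> R; y \<in> R; x < y\<rbrakk> \<Longrightarrow> B x y"
  shows "\<exists>C M. C \<subseteq> Q \<union> R \<and> (\<forall>x\<in>C. \<forall>y\<in>C. x < y \<longrightarrow> B x y) \<and>
    M \<subseteq> {(x, y). x \<in> Q \<and> y \<in> R \<and> \<not> B x y} \<and>
    pairwise (\<lambda>e f. fst e < fst f \<and> snd e < snd f \<or> fst f < fst e \<and> snd f < snd e) M \<and>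
    card Q + card R \<le> card C + 2 * card M"
proof -
  define qs rs where "qs = sorted_list_of_set Q" and "rs = sorted_list_of_set R"
  define p t where "p = card Q" and "t = card R"
  have len: "length qs = p" "length rs = t"
    by (simp_all add: qs_def rs_def p_def t_def)
  have set: "set qs = Q" "set rs = R" using fin by (simp_all add: qs_def rs_def)
  have sw: "sorted_wrt (<) qs" "sorted_wrt (<) rs"
    by (simp_all add: qs_def rs_def)
  have qlt: "qs ! i < qs ! j" if "i < j" "j < p" for i j
    using sorted_wrt_nth_less[OF sw(1)] that len by simp
  have rlt: "rs ! i < rs ! j" if "i < j" "j < t" for i j
    using sorted_wrt_nth_less[OF sw(2)] that len by simp
  have qin: "qs ! i \<in> Q" if "i < p" for i using that len set nth_mem by metis
  have rin: "rs ! i \<in> R" if "i < t" for i using that len set nth_mem by metis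
  \<comment> \<open>The first disjunct stops the search when the shorter chain is exhausted without
    a related pair; \<open>C\<close> then consists of elements of one chain only.\<close>
  define stop where "stop d \<longleftrightarrow> min p t \<le> d \<or> B (qs ! (p - 1 - d)) (rs ! d)" for d
  define d where "d = (LEAST d. stop d)"
  have "stop (min p t)" by (simp add: stop_def)
  then have sd: "stop d" and dle: "d \<le> min p t"
    unfolding d_def by (rule LeastI, rule Least_le)
  have notstop: "\<not> stop k" if "k < d" for k
    using that not_less_Least unfolding d_def by blast
  \<comment> \<open>Transitivity carries a relation between the chains downwards in \<open>Q\<close>
    and upwards in \<open>R\<close>, so one test decides a whole block of pairs.\<close>
  have up: "B (qs ! i) (rs ! j)" if "i \<le> i'" "j' \<le> j" "i' < p" "j < t" "B (qs ! i') (rs ! j')" for i i' j j'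
  proof -
    have 1: "B (qs ! i) (rs ! j')"
    proof (cases "i = i'")
      case False
      then show ?thesis using that qlt[of i i'] qin rin less Q
        by (intro trans[of "qs ! i" "qs ! i'" "rs ! j'"]) auto
    qed (use that in simp)
    show ?thesis
    proof (cases "j' = j")
      case False
      then show ?thesis using that 1 rlt[of j' j] qin rin less R
        by (intro trans[of "qs ! i" "rs ! j'" "rs ! j"]) auto
    qed (use 1 in simp)
  qed
  define M where "M = (\<lambda>i. (qs ! (p - d + i), rs ! i)) ` {..<d}"
  define C where "C = (!) qs ` {..<p - d} \<union> (!) rs ` {d..<t}"
  show ?thesis
  proof (intro exI conjI ballI impI)
    show "C \<subseteq> Q \<union> R" unfolding C_def using qin rin by auto
    show "B x y" if xy: "x \<in> C" "y \<in> C" "x < y" for x y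
    proof -
      consider "x \<in> Q" "y \<in> Q" | "x \<in> R" "y \<in> R" | "x \<in> R" "y \<in> Q"
        | i j where "x = qs ! i" "y = rs ! j" "i < p - d" "d \<le> j" "j < t"
      proof -
        have "x \<in> Q \<and> (\<exists>i<p - d. x = qs ! i) \<or> x \<in> R" "y \<in> Q \<or> y \<in> R \<and> (\<exists>j<t. d \<le> j \<and> y = rs ! j)"
          using xy qin rin unfolding C_def by auto
        then show thesis using that by metis
      qed
      then show ?thesis
      proof cases
        case 1
        then show ?thesis using Q xy(3) by blast
      next
        case 2
        then show ?thesis using R xy(3) by blast
      next
        case 4
        then have "\<not> min p t \<le> d" "i \<le> p - 1 - d" "p - 1 - d < p" by linarith+
        then have "B (qs ! i) (rs ! j)"
          using sd 4(4,5) up[of i "p - 1 - d" d j] unfolding stop_def by blast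
        then show ?thesis unfolding 4 .
      next
        case 3
        then have "y < x" using less by blast
        with xy(3) show ?thesis by (meson less_asym)
      qed
    qed
    show "M \<subseteq> {(x, y). x \<in> Q \<and> y \<in> R \<and> \<not> B x y}"
    proof -
      \<comment> \<open>By \<open>up\<close>, a related pair in \<open>M\<close> would make the pair
        tested at \<open>d - 1\<close> related, although the search did not stop there.\<close>
      have "\<not> B (qs ! (p - d + i)) (rs ! i)" if i: "i < d" for i
      proof
        assume red: "B (qs ! (p - d + i)) (rs ! i)"
        have "B (qs ! (p - 1 - (d - 1))) (rs ! (d - 1))"
          by (rule up[OF _ _ _ _ red]) (use i dle in auto)
        then show False using notstop[of "d - 1"] i by (simp add: stop_def)
      qed
      then show ?thesis unfolding M_def using qin rin dle by auto
    qed
    have lt: "qs ! (p - d + i) < qs ! (p - d + j) \<and> rs ! i < rs ! j" if "i < j" "j < d" for i j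
      using that dle by (intro conjI qlt rlt) linarith+
    have "fst e < fst f \<and> snd e < snd f \<or> fst f < fst e \<and> snd f < snd e"
      if M: "e \<in> M" "f \<in> M" "e \<noteq> f" for e f
    proof -
      obtain i j where ij: "i < d" "j < d" "e = (qs ! (p - d + i), rs ! i)" "f = (qs ! (p - d + j), rs ! j)"
        using M unfolding M_def by auto
      with M(3) have "i \<noteq> j" by auto
      then have "i < j \<or> j < i" by linarith
      then show ?thesis unfolding ij(3,4) fst_conv snd_conv using lt ij(1,2) by blast
    qed
    then show "pairwise (\<lambda>e f. fst e < fst f \<and> snd e < snd f \<or> fst f < fst e \<and> snd f < snd e) M"
      unfolding pairwise_def by blast
    have injr: "inj_on ((!) rs) {..<t}" by (rule linorder_inj_onI') (use rlt in \<open>simp add: less_imp_neq\<close>)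
    have injq: "inj_on ((!) qs) {..<p}" by (rule linorder_inj_onI') (use qlt in \<open>simp add: less_imp_neq\<close>)
    have "inj_on (\<lambda>i. (qs ! (p - d + i), rs ! i)) {..<d}"
      using inj_onD[OF injr] dle by (intro inj_onI) auto
    then have "card M = d" unfolding M_def by (simp add: card_image)
    moreover have "card C = (p - d) + (t - d)"
    proof -
      have "card C = card ((!) qs ` {..<p - d}) + card ((!) rs ` {d..<t})"
        unfolding C_def
      proof (rule card_Un_disjoint)
        have "(!) qs ` {..<p - d} \<subseteq> Q" "(!) rs ` {d..<t} \<subseteq> R" using qin rin by auto
        moreover have "Q \<inter> R = {}" using less by blast
        ultimately show "(!) qs ` {..<p - d} \<inter> (!) rs ` {d..<t} = {}" by blast
      qed simp_all
      also have "card ((!) qs ` {..<p - d}) = p - d"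
        using card_image[OF inj_on_subset[OF injq]] by simp
      also have "card ((!) rs ` {d..<t}) = t - d"
        using card_image[OF inj_on_subset[OF injr], of "{d..<t}"] by (simp add: subset_iff)
      finally show ?thesis .
    qed
    ultimately show "card Q + card R \<le> card C + 2 * card M" unfolding p_def t_def by simp
  qed
qed

lemma split_finite_linorder:
  fixes X :: "'a::linorder set"
  assumes "finite X" "k \<le> card X"
  obtains Y Z where "X = Y \<union> Z" "card Y = k" "card Z = card X - k" "\<And>y z. y \<in> Y \<Longrightarrow> z \<in> Z \<Longrightarrow> y < z"
proof -
  define xs where "xs = sorted_list_of_set X"
  have xs: "set xs = X" "distinct xs" "sorted_wrt (<) xs" "length xs = card X"
    using assms by (simp_all add: xs_def)
  show thesis
  proof (rule that[of "set (take k xs)" "set (drop k xs)"])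
    show "X = set (take k xs) \<union> set (drop k xs)"
      using xs(1) by (metis append_take_drop_id set_append)
    show "card (set (take k xs)) = k" "card (set (drop k xs)) = card X - k"
      using xs assms(2) by (simp_all add: distinct_card)
    show "y < z" if "y \<in> set (take k xs)" "z \<in> set (drop k xs)" for y z
      using xs(3) that by (metis append_take_drop_id sorted_wrt_append)
  qed
qed

text \<open>The two configurations that force a pair of non-\<open>B\<close> edges to be disjoint once \<open>B\<close> is
  \<open>wraps\<close>: separated intervals, and alternating intervals joined by \<open>B\<close> at both ends.\<close>
definition apart :: "('a::linorder \<Rightarrow> 'a \<Rightarrow> bool) \<Rightarrow> 'a \<times> 'a \<Rightarrow> 'a \<times> 'a \<Rightarrow> bool" where
  "apart B e f \<longleftrightarrow> snd e < fst f \<or>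
     fst e < fst f \<and> fst f < snd e \<and> snd e < snd f \<and> B (fst e) (fst f) \<and> B (snd e) (snd f)"

text \<open>With \<open>B\<close> as \<open>wraps\<close>, pairs outside \<open>B\<close> are direct
  edges, and such a matching is a set of pairwise disjoint edges.\<close>

definition gap_matching :: "('a::linorder \<Rightarrow> 'a \<Rightarrow> bool) \<Rightarrow> 'a set \<Rightarrow> ('a \<times> 'a) set \<Rightarrow> bool" where
  "gap_matching B X M \<longleftrightarrow> M \<subseteq> {(x, y). x \<in> X \<and> y \<in> X \<and> x < y \<and> \<not> B x y} \<and>
     pairwise (\<lambda>e f. apart B e f \<or> apart B f e) M"

text \<open>Pairs from different sides fall under the first alternative of
  \<open>apart\<close>.\<close>

lemma gap_matching_union:
  assumes "gap_matching B Y M" "gap_matching B Z N" "\<And>y z. y \<in> Y \<Longrightarrow> z \<in> Z \<Longrightarrow> y < z"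
  shows "gap_matching B (Y \<union> Z) (M \<union> N)"
proof -
  have "apart B e f" if "e \<in> M" "f \<in> N" for e f
  proof -
    have "snd e \<in> Y" "fst f \<in> Z" using that assms(1,2) unfolding gap_matching_def by auto
    then show ?thesis unfolding apart_def using assms(3) by blast
  qed
  then have "pairwise (\<lambda>e f. apart B e f \<or> apart B f e) (M \<union> N)"
    using assms(1,2) unfolding gap_matching_def by (auto intro!: pairwiseI dest: pairwiseD)
  moreover have "M \<union> N \<subseteq> {(x, y). x \<in> Y \<union> Z \<and> y \<in> Y \<union> Z \<and> x < y \<and> \<not> B x y}"
    using assms(1,2) unfolding gap_matching_def by auto
  ultimately show ?thesis unfolding gap_matching_def by simp
qed

text \<open>Bisection. Merging the chains of the two halves costs twice the size of a matching inside the
  node; since such matchings add up over disjoint intervals, each of the \<open>j\<close> levels costs at most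
  twice the largest matching overall.\<close>
lemma chain_or_matching:
  fixes B :: "'a::linorder \<Rightarrow> 'a \<Rightarrow> bool"
  assumes "finite X" "card X \<le> 2 ^ j"
    and "\<And>x y z. \<lbrakk>x \<in> X; y \<in> X; z \<in> X; x < y; y < z; B x y; B y z\<rbrakk> \<Longrightarrow> B x z"
  shows "\<exists>Q M. Q \<subseteq> X \<and> (\<forall>x\<in>Q. \<forall>y\<in>Q. x < y \<longrightarrow> B x y) \<and> gap_matching B X M \<and>
    card X \<le> card Q + 2 * j * card M"
  using assms
proof (induction j arbitrary: X)
  case 0
  then have "\<forall>x\<in>X. \<forall>y\<in>X. x < y \<longrightarrow> B x y"
    by (metis One_nat_def card_le_Suc0_iff_eq less_irrefl power_0)
  then show ?case by (intro exI[of _ X] exI[of _ "{}"]) (auto simp: gap_matching_def)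
next
  case (Suc j)
  obtain Y Z where YZ: "X = Y \<union> Z" "card Y = card X div 2" "card Z = card X - card X div 2"
    "\<And>y z. y \<in> Y \<Longrightarrow> z \<in> Z \<Longrightarrow> y < z"
    using split_finite_linorder[OF Suc.prems(1), of "card X div 2"] by auto
  have sz: "card Y \<le> 2 ^ j" "card Z \<le> 2 ^ j" using YZ Suc.prems(2) by auto
  have fin: "finite Y" "finite Z" using Suc.prems(1) YZ(1) by auto
  have tr: "B x z" if "x \<in> X" "y \<in> X" "z \<in> X" "x < y" "y < z" "B x y" "B y z" for x y z
    using that Suc.prems(3) by blast
  obtain Q1 M1 where 1: "Q1 \<subseteq> Y" "\<forall>x\<in>Q1. \<forall>y\<in>Q1. x < y \<longrightarrow> B x y" "gap_matching B Y M1"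
    "card Y \<le> card Q1 + 2 * j * card M1"
    using Suc.IH[OF fin(1) sz(1)] tr YZ(1) by blast
  obtain Q2 M2 where 2: "Q2 \<subseteq> Z" "\<forall>x\<in>Q2. \<forall>y\<in>Q2. x < y \<longrightarrow> B x y" "gap_matching B Z M2"
    "card Z \<le> card Q2 + 2 * j * card M2"
    using Suc.IH[OF fin(2) sz(2)] tr YZ(1) by blast
  have "finite M1" "finite M2"
    using 1(3) 2(3) fin finite_subset[of M1 "Y \<times> Y"] finite_subset[of M2 "Z \<times> Z"]
    unfolding gap_matching_def by auto
  moreover have "M1 \<inter> M2 = {}"
  proof -
    have "M1 \<subseteq> Y \<times> Y" "M2 \<subseteq> Z \<times> Z" using 1(3) 2(3) unfolding gap_matching_def by auto
    moreover have "Y \<inter> Z = {}" using YZ(4) by blast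
    ultimately show ?thesis by blast
  qed
  ultimately have cU: "card (M1 \<union> M2) = card M1 + card M2" by (rule card_Un_disjoint)
  have less: "x < y" if "x \<in> Q1" "y \<in> Q2" for x y
    using that 1(1) 2(1) YZ(4) by blast
  have "\<exists>C N. C \<subseteq> Q1 \<union> Q2 \<and> (\<forall>x\<in>C. \<forall>y\<in>C. x < y \<longrightarrow> B x y) \<and>
    N \<subseteq> {(x, y). x \<in> Q1 \<and> y \<in> Q2 \<and> \<not> B x y} \<and>
    pairwise (\<lambda>e f. fst e < fst f \<and> snd e < snd f \<or> fst f < fst e \<and> snd f < snd e) N \<and>
    card Q1 + card Q2 \<le> card C + 2 * card N"
  proof (rule merge_chains)
    show "finite Q1" "finite Q2" using 1(1) 2(1) fin finite_subset by blast+
    show "B x z" if "x \<in> Q1 \<union> Q2" "y \<in> Q1 \<union> Q2" "z \<in> Q1 \<union> Q2" "x < y" "y < z" "B x y" "B y z" for x y z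
      using that 1(1) 2(1) YZ(1) tr[of x y z] by blast
    show "x < y" if "x \<in> Q1" "y \<in> Q2" for x y using less that .
    show "B x y" if "x \<in> Q1" "y \<in> Q1" "x < y" for x y using 1(2) that by blast
    show "B x y" if "x \<in> Q2" "y \<in> Q2" "x < y" for x y using 2(2) that by blast
  qed
  then obtain C N where N: "C \<subseteq> Q1 \<union> Q2" "\<forall>x\<in>C. \<forall>y\<in>C. x < y \<longrightarrow> B x y"
    "N \<subseteq> {(x, y). x \<in> Q1 \<and> y \<in> Q2 \<and> \<not> B x y}"
    "pairwise (\<lambda>e f. fst e < fst f \<and> snd e < snd f \<or> fst f < fst e \<and> snd f < snd e) N"
    "card Q1 + card Q2 \<le> card C + 2 * card N"
    by blast
  \<comment> \<open>Left ends lie in the chain \<open>Q1\<close> and right ends in the chain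
    \<open>Q2\<close> to its right, so two such pairs satisfy the second alternative of
    \<open>apart\<close>.\<close>
  have "apart B e f \<or> apart B f e" if "e \<in> N" "f \<in> N" "e \<noteq> f" for e f
  proof -
    have "fst e \<in> Q1" "fst f \<in> Q1" "snd e \<in> Q2" "snd f \<in> Q2" using that N(3) by auto
    moreover have "fst e < fst f \<and> snd e < snd f \<or> fst f < fst e \<and> snd f < snd e"
      using pairwiseD[OF N(4) that] .
    ultimately show ?thesis unfolding apart_def using 1(2) 2(2) less by auto
  qed
  then have "pairwise (\<lambda>e f. apart B e f \<or> apart B f e) N" by (rule pairwiseI)
  moreover have "N \<subseteq> {(x, y). x \<in> X \<and> y \<in> X \<and> x < y \<and> \<not> B x y}"
    using N(3) subsetD[OF 1(1)] subsetD[OF 2(1)] less unfolding YZ(1) by auto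
  ultimately have gN: "gap_matching B X N" unfolding gap_matching_def by blast
  have gU: "gap_matching B X (M1 \<union> M2)"
    unfolding YZ(1) by (rule gap_matching_union[OF 1(3) 2(3) YZ(4)])
  \<comment> \<open>The merge loses at most \<open>2 * card N\<close>, the two halves together at
    most \<open>2 * j * card (M1 \<union> M2)\<close>. Any \<open>M\<close> as large as both
    matchings pays for both losses, so the larger of the two is taken.\<close>
  have *: "card X \<le> card C + 2 * Suc j * card M" if "card N \<le> card M" "card (M1 \<union> M2) \<le> card M" for M :: "('a \<times> 'a) set"
  proof -
    have "2 * j * card M1 + 2 * j * card M2 \<le> 2 * j * card M"
      using that(2) unfolding cU by (metis add_mult_distrib2 mult_le_mono2)
    moreover have "card X = card Y + card Z" using YZ by simp
    ultimately show ?thesis using 1(4) 2(4) N(5) that(1) by simp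
  qed
  have "\<exists>K. gap_matching B X K \<and> card X \<le> card C + 2 * Suc j * card K"
  proof (cases "card N \<le> card (M1 \<union> M2)")
    case True
    show ?thesis by (rule exI[of _ "M1 \<union> M2"]) (rule conjI[OF gU *[OF True order.refl]])
  next
    case False
    then show ?thesis by (intro exI[of _ N] conjI[OF gN *[OF order.refl]]) simp
  qed
  then obtain K where "gap_matching B X K" "card X \<le> card C + 2 * Suc j * card K" by blast
  moreover have "C \<subseteq> X" using N(1) 1(1) 2(1) YZ(1) by blast
  ultimately show ?case using N(2) by meson
qed

subsection \<open>Monotone arcs on the cylinder\<close>

text \<open>Arcs of the circle are handled as intervals \<open>{s..t}\<close> of the universal cover. \<open>ht A\<close> is
  1-periodic and meaningful only over points covered by \<open>A\<close>.\<close>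
definition ht :: "pt set \<Rightarrow> real \<Rightarrow> real" where
  "ht A r = (THE y. (frac r, y) \<in> A)"

definition covers :: "pt set \<Rightarrow> real \<Rightarrow> real \<Rightarrow> bool" where
  "covers A s t \<longleftrightarrow> continuous_on {s..t} (ht A) \<and> (\<forall>r\<in>{s..t}. (frac r, ht A r) \<in> A)"

text \<open>\<open>covers\<close> passes to subintervals, as local comparisons require.
  \<open>spans\<close> also confines the arc from outside, which is what locates its common points
  with other arcs.\<close>

definition spans :: "pt set \<Rightarrow> real \<Rightarrow> real \<Rightarrow> bool" where
  "spans A s t \<longleftrightarrow> covers A s t \<and> (\<forall>p\<in>A. \<exists>r\<in>{s..t}. fst p = frac r)"

lemma frac_eq_near:
  fixes r s :: real
  assumes "frac r = frac s" "\<bar>r - s\<bar> < 1"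
  shows "r = s"
proof -
  have "r - s = of_int (\<lfloor>r\<rfloor> - \<lfloor>s\<rfloor>)"
    using assms(1) by (simp add: frac_def)
  moreover from this have "\<lfloor>r\<rfloor> - \<lfloor>s\<rfloor> = 0" using assms(2) by linarith
  ultimately show ?thesis by simp
qed

lemma frac_neq_near:
  fixes r s :: real
  shows "s < r \<Longrightarrow> r < s + 1 \<Longrightarrow> frac r \<noteq> frac s"
  using frac_eq_near[of r s] by auto

lemma frac_add_of_int [simp]: "frac (r + of_int k) = frac (r::real)"
  by (simp add: frac_def)

lemma x_monotoneD: "\<lbrakk>x_monotone A; p \<in> A; q \<in> A; fst p = fst q\<rbrakk> \<Longrightarrow> p = q"
  unfolding x_monotone_def by blast

lemma ht_eqI:
  assumes "x_monotone A" "(frac r, y) \<in> A"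
  shows "ht A r = y"
proof -
  have "z = y" if "(frac r, z) \<in> A" for z
    using assms that unfolding x_monotone_def by (metis Pair_inject fst_conv)
  then show ?thesis unfolding ht_def using assms(2) by (intro the_equality)
qed

lemma ht_add_int: "ht A (r + of_int k) = ht A r"
  by (simp add: ht_def)

lemma covers_mono: "covers A s t \<Longrightarrow> s \<le> s' \<Longrightarrow> t' \<le> t \<Longrightarrow> covers A s' t'"
  unfolding covers_def by (force intro: continuous_on_subset)

lemma covers_shift:
  assumes "covers A s t"
  shows "covers A (s + of_int k) (t + of_int k)"
proof -
  have ht: "ht A r = ht A (r - of_int k)" and fr: "frac r = frac (r - of_int k)" for r
    by (rule ht_add_int[of A "r - of_int k" k, unfolded diff_add_cancel],
        rule frac_add_of_int[of "r - of_int k" k, unfolded diff_add_cancel])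
  have cont: "continuous_on {s + of_int k..t + of_int k} (\<lambda>r. ht A (r - of_int k))"
  proof (rule continuous_on_compose2[of "{s..t}" "ht A" _ "\<lambda>r. r - of_int k"])
    show "continuous_on {s..t} (ht A)" using assms by (simp add: covers_def)
  qed (auto intro!: continuous_intros)
  have pts: "(frac r, ht A r) \<in> A" if "r \<in> {s + of_int k..t + of_int k}" for r
  proof -
    have "r - of_int k \<in> {s..t}" using that by auto
    then show ?thesis unfolding ht[of r] fr[of r] using assms unfolding covers_def by blast
  qed
  have eq: "(\<lambda>r. ht A (r - of_int k)) = ht A" by (rule ext) (rule ht[symmetric])
  have "continuous_on {s + of_int k..t + of_int k} (ht A)"
    by (rule subst[OF eq, of "continuous_on _"]) (rule cont)
  then show ?thesis unfolding covers_def using pts by blast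
qed

lemma spans_shift:
  assumes "spans A s t"
  shows "spans A (s + of_int k) (t + of_int k)"
  unfolding spans_def
proof (intro conjI ballI covers_shift)
  show "covers A s t" using assms by (simp add: spans_def)
  fix p assume "p \<in> A"
  then obtain r where "r \<in> {s..t}" "fst p = frac r" using assms by (auto simp: spans_def)
  then show "\<exists>r\<in>{s + of_int k..t + of_int k}. fst p = frac r"
    by (intro bexI[of _ "r + of_int k"]) auto
qed

section \<open>Vertical order of two arcs\<close>

text \<open>Otherwise the difference of the two functions has a zero by the intermediate value
  theorem. Every transfer of a height comparison along an interval rests on this.\<close>

lemma same_side:
  fixes f g :: "real \<Rightarrow> real"
  assumes "continuous_on {s..t} f" "continuous_on {s..t} g" "s \<le> t"
    and "\<And>r. r \<in> {s..t} \<Longrightarrow> f r \<noteq> g r"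
  shows "f s < g s \<longleftrightarrow> f t < g t"
proof (rule ccontr)
  assume "(f s < g s) \<noteq> (f t < g t)"
  then have "f s - g s \<le> 0 \<and> 0 \<le> f t - g t \<or> f t - g t \<le> 0 \<and> 0 \<le> f s - g s" by linarith
  moreover have "continuous_on {s..t} (\<lambda>r. f r - g r)" by (intro continuous_intros assms)
  ultimately obtain r where "s \<le> r" "r \<le> t" "f r - g r = 0"
    using IVT'[of "\<lambda>r. f r - g r" s 0 t] IVT2'[of "\<lambda>r. f r - g r" t 0 s] assms(3) by blast
  then show False using assms(4)[of r] by simp
qed

lemma sign_change_meet:
  assumes "covers A s t" "covers B s t" "s \<le> t"
    and "ht A s < ht B s \<longleftrightarrow> ht B t < ht A t" "ht A s \<noteq> ht B s" "ht A t \<noteq> ht B t"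
  obtains r where "s < r" "r < t" "(frac r, ht A r) \<in> A \<inter> B"
proof -
  have "\<not> (ht A s < ht B s \<longleftrightarrow> ht A t < ht B t)" using assms(4-6) by linarith
  then obtain r where r: "r \<in> {s..t}" "ht A r = ht B r"
    using same_side[of s t "ht A" "ht B"] assms(1-3) unfolding covers_def by blast
  then have "(frac r, ht A r) \<in> A \<inter> B" using assms(1,2) unfolding covers_def by (metis IntI)
  moreover have "r \<noteq> s" "r \<noteq> t" using r assms(5,6) by auto
  ultimately show thesis using that[of r] r(1) by force
qed

text \<open>The crossing reverses the order just left and right of \<open>r\<close>. As the interval
  is shorter than a full turn, \<open>r\<close> is the only lift of \<open>fst p\<close> in it, so
  the arcs do not meet elsewhere and \<open>same_side\<close> carries the reversal to both
  ends.\<close>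

lemma proper_crossing_sides:
  assumes mono: "x_monotone A" "x_monotone B"
    and cov: "covers A s t" "covers B s t" "t < s + 1"
    and meet: "A \<inter> B = {p}" and cr: "crosses_at A B p"
    and r: "s < r" "r < t" "fst p = frac r"
  shows "ht A s < ht B s \<longleftrightarrow> ht B t < ht A t"
proof -
  have neq: "ht A q \<noteq> ht B q" if q: "q \<in> {s..t}" "q \<noteq> r" for q
  proof
    assume "ht A q = ht B q"
    then have "(frac q, ht A q) \<in> A \<inter> B" using q cov(1,2) unfolding covers_def by (metis IntI)
    then have "frac q = frac r" using meet r(3) by (metis fst_conv singletonD)
    moreover have "\<bar>q - r\<bar> < 1" using q r cov(3) by auto
    ultimately show False using frac_eq_near q(2) by blast
  qed
  obtain \<delta> where \<delta>: "\<delta> > 0" "\<And>h. 0 < h \<Longrightarrow> h < \<delta> \<Longrightarrow>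
        \<exists>a1\<in>A. \<exists>b1\<in>B. \<exists>a2\<in>A. \<exists>b2\<in>B.
           fst a1 = frac (fst p - h) \<and> fst b1 = frac (fst p - h) \<and>
           fst a2 = frac (fst p + h) \<and> fst b2 = frac (fst p + h) \<and>
           ((snd a1 < snd b1 \<and> snd b2 < snd a2) \<or> (snd b1 < snd a1 \<and> snd a2 < snd b2))"
    using cr unfolding crosses_at_def by blast
  \<comment> \<open>Halving keeps \<open>h\<close> strictly below \<open>\<delta>\<close> and both
    \<open>r - h\<close> and \<open>r + h\<close> inside the interval.\<close>
  define h where "h = min \<delta> (min (r - s) (t - r)) / 2"
  have h: "0 < h" "h < \<delta>" "s \<le> r - h" "r + h \<le> t" using \<delta>(1) r unfolding h_def by (auto simp: min_def field_simps)
  have fr: "frac (fst p - h) = frac (r - h)" "frac (fst p + h) = frac (r + h)"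
    using frac_add_of_int[of "r - h" "- \<lfloor>r\<rfloor>"] frac_add_of_int[of "r + h" "- \<lfloor>r\<rfloor>"]
    unfolding r(3) frac_def[of r] by (simp_all add: algebra_simps)
  have val: "snd a = ht C q" if "x_monotone C" "a \<in> C" "fst a = frac q" for a C q
    using ht_eqI[of C q "snd a"] that by (metis prod.collapse)
  obtain a1 b1 a2 b2 where ab: "a1 \<in> A" "b1 \<in> B" "a2 \<in> A" "b2 \<in> B"
    "fst a1 = frac (r - h)" "fst b1 = frac (r - h)" "fst a2 = frac (r + h)" "fst b2 = frac (r + h)"
    "(snd a1 < snd b1 \<and> snd b2 < snd a2) \<or> (snd b1 < snd a1 \<and> snd a2 < snd b2)"
    using \<delta>(2)[OF h(1,2)] unfolding fr by blast
  have "ht A (r - h) < ht B (r - h) \<longleftrightarrow> ht B (r + h) < ht A (r + h)"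
    using ab(9) val[OF mono(1) ab(1,5)] val[OF mono(2) ab(2,6)] val[OF mono(1) ab(3,7)] val[OF mono(2) ab(4,8)]
    by linarith
  moreover have "ht A s < ht B s \<longleftrightarrow> ht A (r - h) < ht B (r - h)"
    using covers_mono[OF cov(1), of s "r - h"] covers_mono[OF cov(2), of s "r - h"] h r neq
    unfolding covers_def by (intro same_side) auto
  moreover have "ht B (r + h) < ht A (r + h) \<longleftrightarrow> ht B t < ht A t"
    using covers_mono[OF cov(1), of "r + h" t] covers_mono[OF cov(2), of "r + h" t] h r neq[symmetric]
    unfolding covers_def by (intro same_side) auto
  ultimately show ?thesis by blast
qed

section \<open>Monotone arcs as graphs over an interval\<close>

lemma graph_spans:
  assumes mono: "x_monotone A" and A: "A = (\<lambda>r. (frac r, \<phi> r)) ` {\<alpha>..\<beta>}" and \<phi>: "continuous_on {\<alpha>..\<beta>} \<phi>"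
  shows "spans A \<alpha> \<beta>"
proof -
  have ht: "ht A r = \<phi> r" if "r \<in> {\<alpha>..\<beta>}" for r
    using that by (intro ht_eqI[OF mono]) (auto simp: A)
  then have "continuous_on {\<alpha>..\<beta>} (ht A)"
    by (rule continuous_on_cong[THEN iffD2, OF refl _ \<phi>])
  moreover have "(frac r, ht A r) \<in> A" if "r \<in> {\<alpha>..\<beta>}" for r using that ht[OF that] by (simp add: A)
  ultimately show ?thesis unfolding spans_def covers_def by (auto simp: A)
qed

text \<open>The first coordinate \<open>X\<close> of a lifted parametrisation is injective even
  modulo 1, by monotonicity. It is therefore a homeomorphism onto an interval shorter than 1, and
  its inverse \<open>g\<close> presents the arc as a graph.\<close>

lemma monotone_arc_spans:
  assumes arc: "jordan_arc_cyl A u v" and mono: "x_monotone A" and neq: "u \<noteq> v"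
  obtains \<alpha> \<beta> where "\<alpha> < \<beta>" "\<beta> < \<alpha> + 1" "spans A \<alpha> \<beta>"
    "frac \<alpha> = fst u \<and> frac \<beta> = fst v \<or> frac \<alpha> = fst v \<and> frac \<beta> = fst u"
proof -
  obtain \<gamma> :: "real \<Rightarrow> real \<times> real" where \<gamma>: "continuous_on {0..1} \<gamma>" "inj_on (cproj \<circ> \<gamma>) {0..1}"
    "A = (cproj \<circ> \<gamma>) ` {0..1}" "cproj (\<gamma> 0) = u" "cproj (\<gamma> 1) = v"
    using arc unfolding jordan_arc_cyl_def by blast
  define X where "X = fst \<circ> \<gamma>"
  have contX: "continuous_on {0..1} X" unfolding X_def by (intro continuous_on_compose continuous_intros \<gamma>(1))
  have fracX: "s = t" if st: "s \<in> {0..1}" "t \<in> {0..1}" "frac (X s) = frac (X t)" for s t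
  proof -
    have "cproj (\<gamma> s) = cproj (\<gamma> t)"
    proof (rule x_monotoneD[OF mono])
      show "cproj (\<gamma> s) \<in> A" "cproj (\<gamma> t) \<in> A" using st(1,2) unfolding \<gamma>(3) by auto
      show "fst (cproj (\<gamma> s)) = fst (cproj (\<gamma> t))" using st(3) by (simp add: cproj_def X_def)
    qed
    then show ?thesis using inj_onD[OF \<gamma>(2) _ st(1,2)] by simp
  qed
  then have injX: "inj_on X {0..1}" by (intro inj_onI) auto
  obtain \<alpha> \<beta> where im: "X ` {0..1} = {\<alpha>..\<beta>}" "\<alpha> \<le> \<beta>"
    using continuous_image_closed_interval[OF _ contX] by auto
  have ends: "\<alpha> = X 0 \<and> \<beta> = X 1 \<or> \<alpha> = X 1 \<and> \<beta> = X 0"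
  proof -
    obtain a b where ab: "a \<in> {0..1}" "b \<in> {0..1}" "X a = \<alpha>" "X b = \<beta>"
      using im by (metis atLeastAtMost_iff imageE order_refl)
    have bd: "\<alpha> \<le> X t \<and> X t \<le> \<beta>" if "t \<in> {0..1}" for t using that im by auto
    \<comment> \<open>At an interior parameter a continuous injective function lies strictly between
      its two end values, so extrema occur only at the ends.\<close>
    have "a = 0 \<or> a = 1"
      using continuous_inj_imp_mono[OF _ _ contX injX, of a] ab bd[of 0] bd[of 1] by force
    moreover have "b = 0 \<or> b = 1"
      using continuous_inj_imp_mono[OF _ _ contX injX, of b] ab bd[of 0] bd[of 1] by force
    moreover have "a \<noteq> b"
    proof
      assume "a = b"
      then have "X 0 = X 1" using ab bd[of 0] bd[of 1] by auto
      then show False using inj_onD[OF injX, of 0 1] by simp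
    qed
    ultimately show ?thesis using ab by auto
  qed
  define g where "g = inv_into {0..1} X"
  have g: "g (X t) = t" if "t \<in> {0..1}" for t unfolding g_def by (rule inv_into_f_f[OF injX that])
  have gr: "g r \<in> {0..1}" "X (g r) = r" if "r \<in> {\<alpha>..\<beta>}" for r
    using that inv_into_into[of r X "{0..1}"] f_inv_into_f[of r X "{0..1}"] im unfolding g_def by auto
  have contg: "continuous_on {\<alpha>..\<beta>} g"
    using continuous_on_inv[OF contX _ ballI[OF g]] im by auto
  define \<phi> where "\<phi> = snd \<circ> \<gamma> \<circ> g"
  have cont\<phi>: "continuous_on {\<alpha>..\<beta>} \<phi>" unfolding \<phi>_def
    by (intro continuous_on_compose contg continuous_intros continuous_on_subset[OF \<gamma>(1)]) (use gr in auto)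
  have "A = (\<lambda>r. (frac r, \<phi> r)) ` X ` {0..1}"
    unfolding \<gamma>(3) image_image using g by (intro image_cong) (auto simp: \<phi>_def cproj_def X_def)
  then have "spans A \<alpha> \<beta>" using im cont\<phi> by (intro graph_spans[OF mono, of \<phi>]) auto
  moreover have "\<alpha> \<noteq> \<beta>" using ends inj_onD[OF injX, of 0 1] by auto
  \<comment> \<open>Otherwise \<open>X\<close> would attain both \<open>\<alpha>\<close> and
    \<open>\<alpha> + 1\<close>, which lie on the same vertical line.\<close>
  moreover have "\<beta> < \<alpha> + 1"
  proof (rule ccontr)
    assume "\<not> \<beta> < \<alpha> + 1"
    then have in': "\<alpha> \<in> {\<alpha>..\<beta>}" "\<alpha> + 1 \<in> {\<alpha>..\<beta>}" using im(2) by auto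
    have "frac (\<alpha> + 1) = frac \<alpha>" using frac_add_of_int[of \<alpha> 1] by simp
    then have "g \<alpha> = g (\<alpha> + 1)" using fracX[of "g \<alpha>" "g (\<alpha> + 1)"] gr in' by metis
    then show False using gr(2) in' by (metis add_cancel_left_right zero_neq_one)
  qed
  moreover have "frac (X 0) = fst u" "frac (X 1) = fst v" using \<gamma>(4,5) unfolding cproj_def X_def by auto
  ultimately show thesis using that[of \<alpha> \<beta>] ends im(2) by force
qed

text \<open>Shift the spanned interval by an integer so that it starts in \<open>[0, 1)\<close>. It
  then starts at \<open>fst u\<close> or at \<open>fst v\<close>, and being shorter than 1 it must
  end at the next lift of the other endpoint.\<close>

lemma monotone_arc_cases:
  assumes arc: "jordan_arc_cyl A u v" and mono: "x_monotone A"
    and u: "0 \<le> fst u" and v: "fst v < 1" and less: "fst u < fst v"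
  shows "spans A (fst u) (fst v) \<or> spans A (fst v) (fst u + 1)"
proof -
  obtain \<alpha> \<beta> where ab: "\<alpha> < \<beta>" "\<beta> < \<alpha> + 1" "spans A \<alpha> \<beta>"
    "frac \<alpha> = fst u \<and> frac \<beta> = fst v \<or> frac \<alpha> = fst v \<and> frac \<beta> = fst u"
    using monotone_arc_spans[OF arc mono] less by auto
  have sp: "spans A (frac \<alpha>) (\<beta> - of_int \<lfloor>\<alpha>\<rfloor>)"
    using spans_shift[OF ab(3), of "- \<lfloor>\<alpha>\<rfloor>"] by (simp add: frac_def)
  have fb: "frac (\<beta> - of_int \<lfloor>\<alpha>\<rfloor>) = frac \<beta>"
    using frac_add_of_int[of \<beta> "- \<lfloor>\<alpha>\<rfloor>"] by simp
  have bd: "frac \<alpha> < \<beta> - of_int \<lfloor>\<alpha>\<rfloor>" "\<beta> - of_int \<lfloor>\<alpha>\<rfloor> < frac \<alpha> + 1"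
    using ab(1,2) by (auto simp: frac_def)
  have fu: "frac (fst v) = fst v" "frac (fst u) = fst u" using u v less by (auto simp: frac_eq)
  from ab(4) show ?thesis
  proof (elim disjE conjE)
    assume h: "frac \<alpha> = fst u" "frac \<beta> = fst v"
    have "\<beta> - of_int \<lfloor>\<alpha>\<rfloor> = fst v"
      by (rule frac_eq_near) (use h fb fu bd u v less in auto)
    then show ?thesis using sp h by simp
  next
    assume h: "frac \<alpha> = fst v" "frac \<beta> = fst u"
    have fu1: "frac (fst u + 1) = fst u" using frac_add_of_int[of "fst u" 1] fu by simp
    have "\<beta> - of_int \<lfloor>\<alpha>\<rfloor> = fst u + 1"
      by (rule frac_eq_near) (use h fb fu1 bd u v less in auto)
    then show ?thesis using sp h by simp
  qed
qed

lemma spans_fst_bounds: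
  assumes "spans A s t" "p \<in> A" "0 \<le> s" "t < 1"
  shows "s \<le> fst p" "fst p \<le> t"
proof -
  obtain r where r: "r \<in> {s..t}" "fst p = frac r"
    using assms(1,2) unfolding spans_def by (elim conjE ballE bexE) auto
  then have "frac r = r" using assms(3,4) by (simp add: frac_eq)
  then show "s \<le> fst p" "fst p \<le> t" using r by simp_all
qed

subsection \<open>Complete monotone simple drawings\<close>

locale monotone_drawing =
  fixes V :: "pt set" and E :: "pt set \<Rightarrow> pt set"
  assumes complete: "complete_cyl_graph V E"
    and monotone: "monotone_cyl_graph V E"
    and simple: "simple_cyl_graph V E"
begin

lemma edge_in: "u \<in> V \<Longrightarrow> v \<in> V \<Longrightarrow> u \<noteq> v \<Longrightarrow> {u, v} \<in> cedges V"
  unfolding cedges_def by blast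

lemma edge_monotone: "u \<in> V \<Longrightarrow> v \<in> V \<Longrightarrow> u \<noteq> v \<Longrightarrow> x_monotone (E {u, v})"
  using monotone edge_in unfolding monotone_cyl_graph_def by simp

lemma edge_vertices: "u \<in> V \<Longrightarrow> v \<in> V \<Longrightarrow> u \<noteq> v \<Longrightarrow> E {u, v} \<inter> V = {u, v}"
  using complete unfolding complete_cyl_graph_def by simp

lemma ht_vertex:
  assumes "u \<in> V" "v \<in> V" "u \<noteq> v" "fst u = frac t"
  shows "ht (E {u, v}) t = snd u"
proof (rule ht_eqI[OF edge_monotone[OF assms(1-3)]])
  have "u \<in> E {u, v}" using edge_vertices[OF assms(1-3)] by blast
  then show "(frac t, snd u) \<in> E {u, v}" using assms(4) by (metis prod.collapse)
qed

lemma ht_neq_vertex: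
  assumes "u \<in> V" "v \<in> V" "u \<noteq> v" "w \<in> V" "w \<noteq> u" "w \<noteq> v" "fst w = frac r"
    and "covers (E {u, v}) s t" "s \<le> r" "r \<le> t"
  shows "ht (E {u, v}) r \<noteq> snd w"
proof
  assume "ht (E {u, v}) r = snd w"
  moreover have "(frac r, ht (E {u, v}) r) \<in> E {u, v}" using assms(8-10) unfolding covers_def by simp
  ultimately have "w \<in> E {u, v}" using assms(7) by (metis prod.collapse)
  then show False using edge_vertices[OF assms(1-3)] assms(4-6) by blast
qed

lemma edges_meet:
  assumes "e \<in> cedges V" "f \<in> cedges V" "e \<noteq> f"
  shows "E e \<inter> E f = {} \<or>
    (\<exists>p. E e \<inter> E f = {p} \<and> (p \<in> e \<inter> f \<or> (p \<notin> e \<union> f \<and> crosses_at (E e) (E f) p)))"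
  using simple[unfolded simple_cyl_graph_def, rule_format, OF assms] .

lemma adjacent_edges_meet:
  assumes "u \<in> V" "v \<in> V" "w \<in> V" "u \<noteq> v" "u \<noteq> w" "v \<noteq> w"
  shows "E {u, v} \<inter> E {u, w} = {u}"
proof -
  have "{u, v} \<noteq> {u, w}" using assms(6) by (auto simp: doubleton_eq_iff)
  then have "E {u, v} \<inter> E {u, w} = {} \<or> (\<exists>p. E {u, v} \<inter> E {u, w} = {p})"
    using edges_meet[OF edge_in[OF assms(1,2,4)] edge_in[OF assms(1,3,5)]] by blast
  moreover have "u \<in> E {u, v}" "u \<in> E {u, w}"
    using edge_vertices[OF assms(1,2,4)] edge_vertices[OF assms(1,3,5)] by blast+
  ultimately show ?thesis by (metis IntI empty_iff singletonD)
qed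

text \<open>Without a shared endpoint, simplicity leaves only a proper crossing.\<close>

lemma opposite_edges_meet:
  assumes "u \<in> V" "v \<in> V" "w \<in> V" "z \<in> V" "u \<noteq> v" "w \<noteq> z" "u \<noteq> w" "u \<noteq> z" "v \<noteq> w" "v \<noteq> z"
    and "E {u, v} \<inter> E {w, z} \<noteq> {}"
  obtains p where "E {u, v} \<inter> E {w, z} = {p}" "p \<notin> {u, v, w, z}" "crosses_at (E {u, v}) (E {w, z}) p"
proof -
  have ne: "{u, v} \<noteq> {w, z}" and disj: "{u, v} \<inter> {w, z} = {}"
    using assms(5-10) by (auto simp: doubleton_eq_iff)
  obtain p where p: "E {u, v} \<inter> E {w, z} = {p}"
      "p \<in> {u, v} \<inter> {w, z} \<or> (p \<notin> {u, v} \<union> {w, z} \<and> crosses_at (E {u, v}) (E {w, z}) p)"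
    using edges_meet[OF edge_in[OF assms(1,2,5)] edge_in[OF assms(3,4,6)] ne] assms(11) by blast
  with disj show thesis by (intro that[of p]) auto
qed

text \<open>The shared vertex \<open>u\<close> is the only common point, and its lifts nearest to
  the interval are \<open>\<tau>\<close> and \<open>\<tau> + 1\<close>, both outside it. Hence the
  edges do not meet over the interval and keep their order.\<close>

lemma adjacent_side:
  assumes "u \<in> V" "v \<in> V" "w \<in> V" "u \<noteq> v" "u \<noteq> w" "v \<noteq> w"
    and cov: "covers (E {u, v}) a b" "covers (E {u, w}) c d" "a \<le> s" "c \<le> s" "t \<le> b" "t \<le> d"
    and lift: "fst u = frac \<tau>" "\<tau> < s" "s \<le> t" "t < \<tau> + 1"
  shows "ht (E {u, v}) s < ht (E {u, w}) s \<longleftrightarrow> ht (E {u, v}) t < ht (E {u, w}) t"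
proof (rule same_side)
  show "continuous_on {s..t} (ht (E {u, v}))" "continuous_on {s..t} (ht (E {u, w}))"
    using covers_mono[OF cov(1,3,5)] covers_mono[OF cov(2,4,6)] unfolding covers_def by blast+
  show "ht (E {u, v}) r \<noteq> ht (E {u, w}) r" if r: "r \<in> {s..t}" for r
  proof
    assume "ht (E {u, v}) r = ht (E {u, w}) r"
    moreover have "(frac r, ht (E {u, v}) r) \<in> E {u, v}" "(frac r, ht (E {u, w}) r) \<in> E {u, w}"
      using cov r unfolding covers_def by auto
    ultimately have "(frac r, ht (E {u, v}) r) = u" using adjacent_edges_meet[OF assms(1-6)] by auto
    then have "frac r = frac \<tau>" using lift(1) by (metis fst_conv)
    then show False using frac_neq_near[of \<tau> r] r lift by auto
  qed
qed (rule lift(3))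

text \<open>The three arcs would form a simple closed curve winding twice around the cylinder.\<close>
lemma no_winding_two:
  assumes V: "v1 \<in> V" "v2 \<in> V" "v3 \<in> V"
    and lift: "fst v1 = frac t1" "fst v2 = frac t2" "fst v3 = frac t3"
    and t: "t1 < t2" "t2 < t3" "t3 < t1 + 1"
    and cov: "covers (E {v1, v2}) t2 (t1 + 1)" "covers (E {v2, v3}) t3 (t2 + 1)" "covers (E {v1, v3}) t1 t3"
  shows False
proof -
  have ht1: "ht A (r + 1) = ht A r" for A r using ht_add_int[of A r 1] by simp
  have d: "v1 \<noteq> v2" "v2 \<noteq> v3" "v1 \<noteq> v3"
    using lift frac_neq_near[of t1 t2] frac_neq_near[of t2 t3] frac_neq_near[of t1 t3] t by auto
  have cov': "covers (E {v1, v3}) (t1 + 1) (t3 + 1)" using covers_shift[OF cov(3), of 1] by simp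
  have c21: "{v2, v1} = {v1, v2}" and c31: "{v3, v1} = {v1, v3}" and c32: "{v3, v2} = {v2, v3}" by auto
  \<comment> \<open>Suppose \<open>v1v2\<close> passes below \<open>v3\<close>. Comparing it with
    \<open>v1v3\<close> back to \<open>t2\<close> puts \<open>v2\<close> below \<open>v1v3\<close>.
    Comparing it with \<open>v2v3\<close> up to \<open>t1 + 1\<close> puts \<open>v1\<close> below
    \<open>v2v3\<close>, and from there to \<open>t2 + 1\<close> the edge \<open>v1v3\<close> stays
    below \<open>v2v3\<close>, so \<open>v2\<close> is above \<open>v1v3\<close>. The other case is
    the mirror image; each comparison is stated in both orders to transfer strict
    inequalities.\<close>
  have "ht (E {v1, v2}) t3 < ht (E {v2, v3}) t3 \<longleftrightarrow> ht (E {v1, v2}) (t1 + 1) < ht (E {v2, v3}) (t1 + 1)"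
       "ht (E {v2, v3}) t3 < ht (E {v1, v2}) t3 \<longleftrightarrow> ht (E {v2, v3}) (t1 + 1) < ht (E {v1, v2}) (t1 + 1)"
    using adjacent_side[of v2 v1 v3 t2 "t1 + 1" t3 "t2 + 1" t3 "t1 + 1" t2]
      adjacent_side[of v2 v3 v1 t3 "t2 + 1" t2 "t1 + 1" t3 "t1 + 1" t2] V d cov t lift
    unfolding c21 by auto
  moreover have "ht (E {v1, v2}) t2 < ht (E {v1, v3}) t2 \<longleftrightarrow> ht (E {v1, v2}) t3 < ht (E {v1, v3}) t3"
       "ht (E {v1, v3}) t2 < ht (E {v1, v2}) t2 \<longleftrightarrow> ht (E {v1, v3}) t3 < ht (E {v1, v2}) t3"
    using adjacent_side[of v1 v2 v3 t2 "t1 + 1" t1 t3 t2 t3 t1]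
      adjacent_side[of v1 v3 v2 t1 t3 t2 "t1 + 1" t2 t3 t1] V d cov t lift by auto
  moreover have "ht (E {v1, v3}) (t1 + 1) < ht (E {v2, v3}) (t1 + 1) \<longleftrightarrow>
        ht (E {v1, v3}) (t2 + 1) < ht (E {v2, v3}) (t2 + 1)"
       "ht (E {v2, v3}) (t1 + 1) < ht (E {v1, v3}) (t1 + 1) \<longleftrightarrow>
        ht (E {v2, v3}) (t2 + 1) < ht (E {v1, v3}) (t2 + 1)"
    using adjacent_side[of v3 v1 v2 "t1 + 1" "t3 + 1" t3 "t2 + 1" "t1 + 1" "t2 + 1" t3]
      adjacent_side[of v3 v2 v1 t3 "t2 + 1" "t1 + 1" "t3 + 1" "t1 + 1" "t2 + 1" t3] V d cov cov' t lift
    unfolding c31 c32 by auto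
  moreover have "ht (E {v1, v2}) (t1 + 1) = snd v1" "ht (E {v1, v3}) (t1 + 1) = snd v1"
    "ht (E {v1, v2}) t2 = snd v2" "ht (E {v2, v3}) (t2 + 1) = snd v2"
    "ht (E {v1, v3}) t3 = snd v3" "ht (E {v2, v3}) t3 = snd v3"
    using ht_vertex[of v1 v2 t1] ht_vertex[of v1 v3 t1] ht_vertex[of v2 v1 t2] ht_vertex[of v2 v3 t2]
      ht_vertex[of v3 v1 t3] ht_vertex[of v3 v2 t3] V d lift unfolding ht1 c21 c31 c32 by auto
  moreover have "ht (E {v1, v3}) (t2 + 1) = ht (E {v1, v3}) t2" by (rule ht1)
  moreover have "ht (E {v1, v2}) t3 \<noteq> snd v3"
    by (rule ht_neq_vertex[OF _ _ _ _ _ _ _ cov(1)]) (use V d lift t in auto)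
  ultimately show False by (smt (verit))
qed

text \<open>If the two edges crossed, following \<open>v1v2\<close> and \<open>v3v4\<close> past them would make these two
  cross twice, once over \<open>(t4, t1 + 1)\<close> and once over \<open>(t2 + 1, t3 + 1)\<close>.\<close>
lemma alternating_disjoint:
  assumes V: "v1 \<in> V" "v2 \<in> V" "v3 \<in> V" "v4 \<in> V"
    and lift: "fst v1 = frac t1" "fst v2 = frac t2" "fst v3 = frac t3" "fst v4 = frac t4"
    and t: "t1 < t2" "t2 < t3" "t3 < t4" "t4 < t1 + 1"
    and c12: "spans (E {v1, v2}) t2 (t1 + 1)" and c34: "spans (E {v3, v4}) t4 (t3 + 1)"
    and c13: "spans (E {v1, v3}) t3 (t1 + 1)" and c24: "spans (E {v2, v4}) t4 (t2 + 1)"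
  shows "E {v1, v3} \<inter> E {v2, v4} = {}"
proof (rule ccontr)
  assume meet: "E {v1, v3} \<inter> E {v2, v4} \<noteq> {}"
  define A B C D where "A = E {v1, v3}" and "B = E {v2, v4}" and "C = E {v1, v2}" and "D = E {v3, v4}"
  have ht1: "ht X (r + 1) = ht X r" for X r using ht_add_int[of X r 1] by simp
  have frac1: "frac (r + 1) = frac r" for r :: real using frac_add_of_int[of r 1] by simp
  have d: "v1 \<noteq> v2" "v1 \<noteq> v3" "v1 \<noteq> v4" "v2 \<noteq> v3" "v2 \<noteq> v4" "v3 \<noteq> v4"
    using lift frac_neq_near[of t1 t2] frac_neq_near[of t1 t3] frac_neq_near[of t1 t4]
      frac_neq_near[of t2 t3] frac_neq_near[of t2 t4] frac_neq_near[of t3 t4] t by auto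
  have sym: "E {v3, v1} = A" "E {v4, v2} = B" "E {v2, v1} = C" "E {v4, v3} = D"
    "E {v1, v3} = A" "E {v2, v4} = B" "E {v1, v2} = C" "E {v3, v4} = D"
    unfolding A_def B_def C_def D_def by (simp_all add: insert_commute)
  have cov: "covers A t3 (t1 + 1)" "covers B t4 (t2 + 1)" "covers C t2 (t1 + 1)" "covers D t4 (t3 + 1)"
    using c12 c34 c13 c24 unfolding spans_def sym by blast+
  \<comment> \<open>The second crossing lies beyond \<open>t1 + 1\<close>, hence on the next lift of
    \<open>C\<close>.\<close>
  have covC: "covers C (t2 + 1) (t1 + 2)" using covers_shift[OF cov(3), of 1] by (simp add: add.assoc)
  obtain p where p: "A \<inter> B = {p}" "p \<notin> {v1, v3, v2, v4}" "crosses_at A B p"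
    using opposite_edges_meet[of v1 v3 v2 v4] V d meet unfolding sym by metis
  have mono: "x_monotone A" "x_monotone B"
    using edge_monotone[of v1 v3] edge_monotone[of v2 v4] V d unfolding sym by auto
  have inAB: "v1 \<in> A" "v4 \<in> B"
    using edge_vertices[of v1 v3] edge_vertices[of v2 v4] V d unfolding sym by auto
  obtain r r' where r: "t3 \<le> r" "r \<le> t1 + 1" "fst p = frac r" and r': "t4 \<le> r'" "r' \<le> t2 + 1" "fst p = frac r'"
    using c13 c24 p(1) unfolding spans_def sym by (metis IntD1 IntD2 atLeastAtMost_iff singletonI)
  \<comment> \<open>The two spans put the same lift of \<open>p\<close> into
    \<open>{t4..t1 + 1}\<close>; since \<open>p\<close> is not a vertex, it lies strictly
    inside.\<close>
  have "r = r'" by (rule frac_eq_near) (use r r' t in auto)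
  then have "t4 \<le> r" using r' by simp
  moreover have "r \<noteq> t4"
    using x_monotoneD[OF mono(2), of p v4] p inAB r(3) lift(4) by auto
  moreover have "r \<noteq> t1 + 1"
    using x_monotoneD[OF mono(1), of p v1] p inAB r(3) lift(1) frac1 by auto
  ultimately have sides: "ht A t4 < ht B t4 \<longleftrightarrow> ht B (t1 + 1) < ht A (t1 + 1)"
    using r t by (intro proper_crossing_sides[OF mono covers_mono[OF cov(1)] covers_mono[OF cov(2)] _ p(1,3), of t4 "t1 + 1" r]) auto
  \<comment> \<open>Say \<open>A\<close> passes below \<open>v4\<close> at \<open>t4\<close>; the
    other case is the mirror image. The crossing puts \<open>B\<close> below \<open>v1\<close> at
    \<open>t1 + 1\<close>. Then \<open>CB\<close> puts \<open>C\<close> above \<open>v4\<close>, and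
    \<open>CA\<close> puts \<open>C\<close> above \<open>v3\<close>; likewise \<open>DA\<close> puts
    \<open>D\<close> above \<open>v1\<close>, and \<open>DB\<close> puts \<open>D\<close> above
    \<open>v2\<close>. So \<open>C\<close> and \<open>D\<close> change order over both
    intervals.\<close>
  have CB: "ht C t4 < ht B t4 \<longleftrightarrow> ht C (t1 + 1) < ht B (t1 + 1)"
           "ht B t4 < ht C t4 \<longleftrightarrow> ht B (t1 + 1) < ht C (t1 + 1)"
    using adjacent_side[of v2 v1 v4 t2 "t1 + 1" t4 "t2 + 1" t4 "t1 + 1" t2]
      adjacent_side[of v2 v4 v1 t4 "t2 + 1" t2 "t1 + 1" t4 "t1 + 1" t2] V d cov t lift
    unfolding sym by auto
  have CA: "ht C t3 < ht A t3 \<longleftrightarrow> ht C t4 < ht A t4" "ht A t3 < ht C t3 \<longleftrightarrow> ht A t4 < ht C t4"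
    using adjacent_side[of v1 v2 v3 t2 "t1 + 1" t3 "t1 + 1" t3 t4 t1]
      adjacent_side[of v1 v3 v2 t3 "t1 + 1" t2 "t1 + 1" t3 t4 t1] V d cov t lift
    unfolding sym by auto
  have DA: "ht D t4 < ht A t4 \<longleftrightarrow> ht D (t1 + 1) < ht A (t1 + 1)"
           "ht A t4 < ht D t4 \<longleftrightarrow> ht A (t1 + 1) < ht D (t1 + 1)"
    using adjacent_side[of v3 v4 v1 t4 "t3 + 1" t3 "t1 + 1" t4 "t1 + 1" t3]
      adjacent_side[of v3 v1 v4 t3 "t1 + 1" t4 "t3 + 1" t4 "t1 + 1" t3] V d cov t lift
    unfolding sym by auto
  have DB: "ht D (t1 + 1) < ht B (t1 + 1) \<longleftrightarrow> ht D (t2 + 1) < ht B (t2 + 1)"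
           "ht B (t1 + 1) < ht D (t1 + 1) \<longleftrightarrow> ht B (t2 + 1) < ht D (t2 + 1)"
    using adjacent_side[of v4 v3 v2 t4 "t3 + 1" t4 "t2 + 1" "t1 + 1" "t2 + 1" t4]
      adjacent_side[of v4 v2 v3 t4 "t2 + 1" t4 "t3 + 1" "t1 + 1" "t2 + 1" t4] V d cov t lift
    unfolding sym by auto
  have val: "ht A (t1 + 1) = snd v1" "ht C (t1 + 1) = snd v1" "ht C (t2 + 1) = snd v2" "ht B (t2 + 1) = snd v2"
    "ht A t3 = snd v3" "ht D (t3 + 1) = snd v3" "ht B t4 = snd v4" "ht D t4 = snd v4"
    using ht_vertex[of v1 v3 t1] ht_vertex[of v1 v2 t1] ht_vertex[of v2 v1 t2] ht_vertex[of v2 v4 t2]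
      ht_vertex[of v3 v1 t3] ht_vertex[of v3 v4 t3] ht_vertex[of v4 v2 t4] ht_vertex[of v4 v3 t4] V d lift
    unfolding sym ht1 by auto
  have neq: "ht A t4 \<noteq> snd v4" "ht C t4 \<noteq> snd v4" "ht C t3 \<noteq> snd v3"
      "ht D (t1 + 1) \<noteq> snd v1" "ht D (t2 + 1) \<noteq> snd v2"
    using ht_neq_vertex[of v1 v3 v4 t4 t3 "t1 + 1"] ht_neq_vertex[of v1 v2 v4 t4 t2 "t1 + 1"]
      ht_neq_vertex[of v1 v2 v3 t3 t2 "t1 + 1"] ht_neq_vertex[of v3 v4 v1 "t1 + 1" t4 "t3 + 1"]
      ht_neq_vertex[of v3 v4 v2 "t2 + 1" t4 "t3 + 1"] V d cov t lift
    unfolding sym frac1 by auto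
  have s1: "ht C t4 < ht D t4 \<longleftrightarrow> ht D (t1 + 1) < ht C (t1 + 1)"
    using sides CB CA DA DB val neq by (smt (verit))
  have s2: "ht C (t2 + 1) < ht D (t2 + 1) \<longleftrightarrow> ht D (t3 + 1) < ht C (t3 + 1)"
    unfolding ht1[of C t3] using sides CB CA DA DB val neq by (smt (verit))
  obtain r1 where r1: "t4 < r1" "r1 < t1 + 1" "(frac r1, ht C r1) \<in> C \<inter> D"
    by (rule sign_change_meet[OF covers_mono[OF cov(3)] covers_mono[OF cov(4)] _ s1]) (use t val neq in auto)
  obtain r2 where r2: "t2 + 1 < r2" "r2 < t3 + 1" "(frac r2, ht C r2) \<in> C \<inter> D"
    by (rule sign_change_meet[OF covers_mono[OF covC] covers_mono[OF cov(4)] _ s2]) (use t val neq ht1 in auto)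
  obtain q where "C \<inter> D = {q}"
    using opposite_edges_meet[of v1 v2 v3 v4] V d r1(3) unfolding sym by (metis empty_iff)
  \<comment> \<open>A single common point has one lift within less than a turn, but the two
    intervals are disjoint.\<close>
  then have "frac r1 = frac r2" using r1(3) r2(3) by (metis fst_conv singletonD)
  then have "r1 = r2" by (rule frac_eq_near) (use r1 r2 t in auto)
  then show False using r1 r2 t by simp
qed

section \<open>Vertices and edges indexed by x-coordinates\<close>

text \<open>Replacing vertices by their distinct x-coordinates makes the order results on linear
  orders applicable.\<close>

definition vtx :: "real \<Rightarrow> pt" where "vtx = inv_into V fst"

definition edge :: "real \<times> real \<Rightarrow> pt set" where "edge e = {vtx (fst e), vtx (snd e)}"

definition wraps :: "real \<Rightarrow> real \<Rightarrow> bool" where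
  "wraps x y \<longleftrightarrow> spans (E (edge (x, y))) y (x + 1)"

lemma vtx:
  assumes "x \<in> fst ` V"
  shows "vtx x \<in> V" "fst (vtx x) = x"
  unfolding vtx_def by (rule inv_into_into[OF assms], rule f_inv_into_f[OF assms])

lemma x_range:
  assumes "x \<in> fst ` V"
  shows "0 \<le> x" "x < 1"
proof -
  have "V \<subseteq> cyl" using complete unfolding complete_cyl_graph_def by simp
  then have "vtx x \<in> cyl" using vtx(1)[OF assms] by blast
  then show "0 \<le> x" "x < 1" using vtx(2)[OF assms] unfolding cyl_def by auto
qed

lemma vtx_lift:
  assumes "x \<in> fst ` V"
  shows "fst (vtx x) = frac x" "fst (vtx x) = frac (x + 1)"
  using vtx(2)[OF assms] x_range[OF assms] frac_add_of_int[of x 1] by (simp_all add: frac_eq)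

lemma direct_or_wraps:
  assumes "x \<in> fst ` V" "y \<in> fst ` V" "x < y"
  shows "spans (E (edge (x, y))) x y \<or> wraps x y"
proof -
  have neq: "vtx x \<noteq> vtx y" using vtx(2)[OF assms(1)] vtx(2)[OF assms(2)] assms(3) by auto
  have "jordan_arc_cyl (E {vtx x, vtx y}) (vtx x) (vtx y)"
    using complete vtx(1)[OF assms(1)] vtx(1)[OF assms(2)] neq unfolding complete_cyl_graph_def by simp
  then have "spans (E {vtx x, vtx y}) (fst (vtx x)) (fst (vtx y)) \<or>
      spans (E {vtx x, vtx y}) (fst (vtx y)) (fst (vtx x) + 1)"
  proof (rule monotone_arc_cases)
    show "x_monotone (E {vtx x, vtx y})" by (rule edge_monotone[OF vtx(1)[OF assms(1)] vtx(1)[OF assms(2)] neq])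
  qed (simp_all add: vtx(2)[OF assms(1)] vtx(2)[OF assms(2)] x_range assms)
  then show ?thesis
    unfolding wraps_def edge_def by (simp add: vtx(2)[OF assms(1)] vtx(2)[OF assms(2)])
qed

text \<open>A direct edge between \<open>x\<close> and \<open>z\<close> would complete the
  configuration excluded by \<open>no_winding_two\<close>.\<close>

lemma wraps_trans:
  assumes X: "x \<in> fst ` V" "y \<in> fst ` V" "z \<in> fst ` V" and "x < y" "y < z" and w: "wraps x y" "wraps y z"
  shows "wraps x z"
proof (rule ccontr)
  assume "\<not> wraps x z"
  then have "spans (E {vtx x, vtx z}) x z" using direct_or_wraps[of x z] assms unfolding edge_def by auto
  moreover have "z < x + 1" using x_range[OF X(1)] x_range[OF X(3)] by simp
  ultimately show False
    using no_winding_two[OF vtx(1)[OF X(1)] vtx(1)[OF X(2)] vtx(1)[OF X(3)]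
        vtx_lift(1)[OF X(1)] vtx_lift(1)[OF X(2)] vtx_lift(1)[OF X(3)] assms(4,5)] w
    unfolding wraps_def spans_def edge_def by simp
qed

lemma wrapping_alternating_disjoint:
  assumes X: "x1 \<in> fst ` V" "x2 \<in> fst ` V" "x3 \<in> fst ` V" "x4 \<in> fst ` V"
    and lt: "x1 < x2" "x2 < x3" "x3 < x4"
    and w: "wraps x1 x2" "wraps x3 x4" "wraps x1 x3" "wraps x2 x4"
  shows "E (edge (x1, x3)) \<inter> E (edge (x2, x4)) = {}"
proof -
  have "x4 < x1 + 1" using x_range[OF X(1)] x_range[OF X(4)] by simp
  then show ?thesis
    using alternating_disjoint[OF vtx(1)[OF X(1)] vtx(1)[OF X(2)] vtx(1)[OF X(3)] vtx(1)[OF X(4)]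
        vtx_lift(1)[OF X(1)] vtx_lift(1)[OF X(2)] vtx_lift(1)[OF X(3)] vtx_lift(1)[OF X(4)] lt] w
    unfolding wraps_def edge_def by simp
qed

text \<open>The same configuration seen from the cut between \<open>x2\<close> and \<open>x3\<close>.\<close>
lemma direct_alternating_disjoint:
  assumes X: "x1 \<in> fst ` V" "x2 \<in> fst ` V" "x3 \<in> fst ` V" "x4 \<in> fst ` V"
    and lt: "x1 < x2" "x2 < x3" "x3 < x4"
    and w: "wraps x1 x2" "wraps x3 x4" "spans (E (edge (x1, x3))) x1 x3" "spans (E (edge (x2, x4))) x2 x4"
  shows "E (edge (x1, x3)) \<inter> E (edge (x2, x4)) = {}"
proof -
  have t: "x4 < x1 + 1" "x1 + 1 < x2 + 1" "x2 + 1 < x3 + 1"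
    using lt x_range[OF X(1)] x_range[OF X(4)] by simp_all
  have "E {vtx x3, vtx x1} \<inter> E {vtx x4, vtx x2} = {}"
  \<comment> \<open>The roles of \<open>v1, v2, v3, v4\<close> are taken by
    \<open>x3, x4, x1, x2\<close> at the lifts \<open>x3 < x4 < x1 + 1 < x2 + 1\<close>. From this
    cut the direct edges become wrapping ones, while the edges \<open>x1x2\<close> and
    \<open>x3x4\<close> still wrap.\<close>
  proof (rule alternating_disjoint[OF vtx(1)[OF X(3)] vtx(1)[OF X(4)] vtx(1)[OF X(1)] vtx(1)[OF X(2)]
        vtx_lift(1)[OF X(3)] vtx_lift(1)[OF X(4)] vtx_lift(2)[OF X(1)] vtx_lift(2)[OF X(2)] lt(3) t])
    show "spans (E {vtx x3, vtx x4}) x4 (x3 + 1)" using w(2) unfolding wraps_def edge_def by simp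
    show "spans (E {vtx x1, vtx x2}) (x2 + 1) (x1 + 1 + 1)"
      using spans_shift[of "E {vtx x1, vtx x2}" x2 "x1 + 1" 1] w(1) unfolding wraps_def edge_def by simp
    show "spans (E {vtx x3, vtx x1}) (x1 + 1) (x3 + 1)"
      using spans_shift[of "E {vtx x1, vtx x3}" x1 x3 1] w(3) unfolding edge_def by (simp add: insert_commute)
    show "spans (E {vtx x4, vtx x2}) (x2 + 1) (x4 + 1)"
      using spans_shift[of "E {vtx x2, vtx x4}" x2 x4 1] w(4) unfolding edge_def by (simp add: insert_commute)
  qed
  then show ?thesis unfolding edge_def by (simp add: insert_commute)
qed

lemma direct_separated_disjoint:
  assumes X: "x1 \<in> fst ` V" "x2 \<in> fst ` V" "x3 \<in> fst ` V" "x4 \<in> fst ` V" and "x2 < x3"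
    and w: "spans (E (edge (x1, x2))) x1 x2" "spans (E (edge (x3, x4))) x3 x4"
  shows "E (edge (x1, x2)) \<inter> E (edge (x3, x4)) = {}"
proof -
  have False if p: "p \<in> E (edge (x1, x2))" "p \<in> E (edge (x3, x4))" for p
    using spans_fst_bounds(2)[OF w(1) p(1) x_range(1)[OF X(1)] x_range(2)[OF X(2)]]
      spans_fst_bounds(1)[OF w(2) p(2) x_range(1)[OF X(3)] x_range(2)[OF X(4)]] assms(5) by simp
  then show ?thesis by blast
qed

section \<open>Disjoint edges from matchings and chains\<close>

text \<open>The two alternatives of \<open>apart\<close> are the hypotheses of
  \<open>direct_separated_disjoint\<close> and \<open>direct_alternating_disjoint\<close>.\<close>

lemma gap_matching_disjoint:
  assumes "gap_matching wraps (fst ` V) N"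
  shows "pairwise (\<lambda>e f. E (edge e) \<inter> E (edge f) = {}) N"
proof -
  have N: "fst e \<in> fst ` V" "snd e \<in> fst ` V" "spans (E (edge (fst e, snd e))) (fst e) (snd e)" if "e \<in> N" for e
  proof -
    have "e \<in> {(x, y). x \<in> fst ` V \<and> y \<in> fst ` V \<and> x < y \<and> \<not> wraps x y}"
      using assms that unfolding gap_matching_def by (elim conjE subsetD)
    then have "fst e \<in> fst ` V \<and> snd e \<in> fst ` V \<and> fst e < snd e \<and> \<not> wraps (fst e) (snd e)"
      unfolding mem_Collect_eq case_prod_beta .
    then show "fst e \<in> fst ` V" "snd e \<in> fst ` V" "spans (E (edge (fst e, snd e))) (fst e) (snd e)"
      using direct_or_wraps by blast+
  qed
  have *: "E (edge e) \<inter> E (edge f) = {}" if ef: "e \<in> N" "f \<in> N" "apart wraps e f" for e f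
    using ef(3) direct_separated_disjoint[OF N(1,2)[OF ef(1)] N(1,2)[OF ef(2)] _ N(3)[OF ef(1)] N(3)[OF ef(2)]]
      direct_alternating_disjoint[OF N(1)[OF ef(1)] N(1)[OF ef(2)] N(2)[OF ef(1)] N(2)[OF ef(2)] _ _ _ _ _
        N(3)[OF ef(1)] N(3)[OF ef(2)]]
    unfolding apart_def prod.collapse by blast
  show ?thesis
  proof (rule pairwiseI)
    fix e f assume "e \<in> N" "f \<in> N" "e \<noteq> f"
    then have "apart wraps e f \<or> apart wraps f e"
      using assms unfolding gap_matching_def by (auto dest: pairwiseD)
    then show "E (edge e) \<inter> E (edge f) = {}" using * \<open>e \<in> N\<close> \<open>f \<in> N\<close> by (metis Int_commute)
  qed
qed

lemma wrapping_chain_matching: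
  assumes "Q \<subseteq> fst ` V" "\<forall>x\<in>Q. \<forall>y\<in>Q. x < y \<longrightarrow> wraps x y"
  obtains N where "N \<subseteq> {(x, y). x \<in> fst ` V \<and> y \<in> fst ` V \<and> x < y}"
    "pairwise (\<lambda>e f. E (edge e) \<inter> E (edge f) = {}) N" "card N = card Q div 2"
proof -
  have "finite V" using complete unfolding complete_cyl_graph_def by simp
  then have "finite Q" by (intro finite_subset[OF assms(1)] finite_imageI)
  define qs where "qs = sorted_list_of_set Q"
  define m where "m = card Q div 2"
  have qs: "set qs = Q" "length qs = card Q" "sorted_wrt (<) qs"
    using \<open>finite Q\<close> by (simp_all add: qs_def)
  have lt: "qs ! i < qs ! j" if "i < j" "j < card Q" for i j
    using sorted_wrt_nth_less[OF qs(3)] that qs(2) by simp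
  have mem: "qs ! i \<in> Q" if "i < card Q" for i using nth_mem[of i qs] that qs by simp
  have m2: "m + m \<le> card Q" unfolding m_def by linarith
  \<comment> \<open>A shift by half the chain makes any two pairs alternate, since their indices
    differ by less than \<open>m\<close>. In a chain of odd size the last vertex stays
    unmatched.\<close>
  define N where "N = (\<lambda>i. (qs ! i, qs ! (i + m))) ` {..<m}"
  have *: "E (edge (qs ! i, qs ! (i + m))) \<inter> E (edge (qs ! k, qs ! (k + m))) = {}" if "i < k" "k < m" for i k
  proof -
    have less: "qs ! i < qs ! k" "qs ! k < qs ! (i + m)" "qs ! (i + m) < qs ! (k + m)"
      using that m2 by (intro lt; linarith)+
    have mems: "qs ! i \<in> Q" "qs ! k \<in> Q" "qs ! (i + m) \<in> Q" "qs ! (k + m) \<in> Q"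
      using that m2 by (intro mem; linarith)+
    show ?thesis
      by (rule wrapping_alternating_disjoint) (use less mems assms in auto)
  qed
  show thesis
  proof (rule that[of N])
    have "qs ! i < qs ! (i + m)" "qs ! i \<in> Q" "qs ! (i + m) \<in> Q" if "i < m" for i
      using that m2 by (intro lt mem; linarith)+
    then show "N \<subseteq> {(x, y). x \<in> fst ` V \<and> y \<in> fst ` V \<and> x < y}"
      unfolding N_def using assms(1) by blast
    show "pairwise (\<lambda>e f. E (edge e) \<inter> E (edge f) = {}) N"
    proof (rule pairwiseI)
      fix e f assume "e \<in> N" "f \<in> N" "e \<noteq> f"
      then obtain i k where ik: "i < m" "k < m" "i \<noteq> k" "e = (qs ! i, qs ! (i + m))" "f = (qs ! k, qs ! (k + m))"
        unfolding N_def by blast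
      then show "E (edge e) \<inter> E (edge f) = {}"
        using *[of i k] *[of k i] by (cases "i < k") auto
    qed
    have "inj_on (\<lambda>i. (qs ! i, qs ! (i + m))) {..<m}"
    proof (rule linorder_inj_onI')
      fix i j assume "i \<in> {..<m}" "j \<in> {..<m}" "i < j"
      then have "qs ! i < qs ! j" using m2 by (intro lt) auto
      then show "(qs ! i, qs ! (i + m)) \<noteq> (qs ! j, qs ! (j + m))" by simp
    qed
    then show "card N = card Q div 2" unfolding N_def m_def by (simp add: card_image)
  qed
qed

lemma edges_of_pairs:
  assumes "N \<subseteq> {(x, y). x \<in> fst ` V \<and> y \<in> fst ` V \<and> x < y}"
    and "pairwise (\<lambda>e f. E (edge e) \<inter> E (edge f) = {}) N"
  shows "edge ` N \<subseteq> cedges V" "\<forall>e\<in>edge ` N. \<forall>f\<in>edge ` N. e \<noteq> f \<longrightarrow> E e \<inter> E f = {}"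
    "card (edge ` N) = card N"
proof -
  have N: "fst e \<in> fst ` V" "snd e \<in> fst ` V" "fst e < snd e" if "e \<in> N" for e
    using subsetD[OF assms(1) that] unfolding mem_Collect_eq case_prod_beta by blast+
  have "edge e \<in> cedges V" if "e \<in> N" for e
    unfolding edge_def
  proof (rule edge_in)
    show "vtx (fst e) \<noteq> vtx (snd e)" using vtx(2)[OF N(1)[OF that]] vtx(2)[OF N(2)[OF that]] N(3)[OF that] by auto
  qed (rule vtx(1)[OF N(1)[OF that]] vtx(1)[OF N(2)[OF that]])+
  then show "edge ` N \<subseteq> cedges V" by blast
  show "\<forall>e\<in>edge ` N. \<forall>f\<in>edge ` N. e \<noteq> f \<longrightarrow> E e \<inter> E f = {}"
  proof (intro ballI impI)
    fix e f assume "e \<in> edge ` N" "f \<in> edge ` N" "e \<noteq> f"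
    then obtain a b where "a \<in> N" "b \<in> N" "a \<noteq> b" and "e = edge a" "f = edge b" by (elim imageE) auto
    then show "E e \<inter> E f = {}" using pairwiseD[OF assms(2)] by simp
  qed
  have "inj_on edge N"
  proof (rule inj_onI)
    fix e f assume ef: "e \<in> N" "f \<in> N" "edge e = edge f"
    \<comment> \<open>The x-coordinates of an edge recover its pair, as the smaller one comes
      first.\<close>
    have "fst ` edge g = {fst g, snd g}" if "g \<in> N" for g
      using vtx(2)[OF N(1)[OF that]] vtx(2)[OF N(2)[OF that]] unfolding edge_def by simp
    then have "{fst e, snd e} = {fst f, snd f}" using ef by metis
    then show "e = f" using N(3)[OF ef(1)] N(3)[OF ef(2)] by (auto simp: doubleton_eq_iff prod_eq_iff)
  qed
  then show "card (edge ` N) = card N" by (rule card_image)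
qed

lemma disjoint_edges_log:
  assumes "card V \<le> 2 ^ j" "2 \<le> card V"
  obtains M where "M \<subseteq> cedges V" "\<forall>e\<in>M. \<forall>f\<in>M. e \<noteq> f \<longrightarrow> E e \<inter> E f = {}"
    "card V \<le> (2 * j + 3) * card M"
proof -
  have "inj_on fst V" "finite V"
    using monotone complete unfolding monotone_cyl_graph_def complete_cyl_graph_def by auto
  then have cX: "card (fst ` V) = card V" and fX: "finite (fst ` V)" by (simp_all add: card_image)
  obtain Q N where QN: "Q \<subseteq> fst ` V" "\<forall>x\<in>Q. \<forall>y\<in>Q. x < y \<longrightarrow> wraps x y"
    "gap_matching wraps (fst ` V) N" "card V \<le> card Q + 2 * j * card N"
    using chain_or_matching[OF fX, of j wraps] wraps_trans assms(1) unfolding cX by blast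
  have N: "N \<subseteq> {(x, y). x \<in> fst ` V \<and> y \<in> fst ` V \<and> x < y}"
    using QN(3) unfolding gap_matching_def by auto
  obtain N' where N': "N' \<subseteq> {(x, y). x \<in> fst ` V \<and> y \<in> fst ` V \<and> x < y}"
    "pairwise (\<lambda>e f. E (edge e) \<inter> E (edge f) = {}) N'" "card N' = card Q div 2"
    using wrapping_chain_matching[OF QN(1,2)] .
  \<comment> \<open>The chain contributes at most \<open>2 * card K + 1\<close>, the 1 from
    rounding, and the bisection \<open>2 * j * card K\<close>. Since \<open>card V\<close> is at
    least 2, \<open>K\<close> is nonempty and absorbs the 1, which gives the factor
    \<open>2 * j + 3\<close>.\<close>
  define K where "K = (if card N \<le> card N' then N' else N)"
  have K: "K \<subseteq> {(x, y). x \<in> fst ` V \<and> y \<in> fst ` V \<and> x < y}"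
    "pairwise (\<lambda>e f. E (edge e) \<inter> E (edge f) = {}) K"
    using N N'(1,2) gap_matching_disjoint[OF QN(3)] unfolding K_def by auto
  have "card N \<le> card K" "card Q \<le> 2 * card K + 1" using N'(3) unfolding K_def by auto
  then have le: "card V \<le> 2 * card K + 1 + 2 * j * card K"
    using QN(4) mult_le_mono2[of "card N" "card K" "2 * j"] by linarith
  then have "card K \<noteq> 0" using assms(2) by (intro notI) simp
  then have "card V \<le> (2 * j + 3) * card K" using le by (simp add: algebra_simps)
  then show thesis using that[OF edges_of_pairs(1,2)[OF K]] edges_of_pairs(3)[OF K] by simp
qed

end

section \<open>From the logarithmic to the power bound\<close>

text \<open>The logarithmic loss is dominated by a constant times \<open>n powr \<epsilon>\<close>.
  A single vertex has no edge although its power is 1, hence the bound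
  \<open>card V \<ge> 2\<close>.\<close>

theorem theorem2:
  fixes \<epsilon> :: real
  assumes "\<epsilon> > 0"
  shows "\<exists>c>0. \<forall>V E. complete_cyl_graph V E \<and> monotone_cyl_graph V E \<and> simple_cyl_graph V E
           \<and> card V \<ge> 2 \<longrightarrow>
           (\<exists>M. M \<subseteq> cedges V \<and> (\<forall>e\<in>M. \<forall>f\<in>M. e \<noteq> f \<longrightarrow> E e \<inter> E f = {}) \<and>
                real (card M) \<ge> c * real (card V) powr (1 - \<epsilon>))"
proof -
  \<comment> \<open>Chosen from \<open>2 * j + 3 \<le> 2 * log 2 n + 5 \<le> 4 * ln n + 5\<close>,
    where \<open>ln n \<le> n powr \<epsilon> / \<epsilon>\<close> and
    \<open>1 \<le> n powr \<epsilon>\<close>.\<close>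
  define C where "C = 5 + 4 / \<epsilon>"
  have C: "C > 0" using assms unfolding C_def by (simp add: add_pos_pos)
  have main: "\<exists>M. M \<subseteq> cedges V \<and> (\<forall>e\<in>M. \<forall>f\<in>M. e \<noteq> f \<longrightarrow> E e \<inter> E f = {}) \<and>
                real (card M) \<ge> 1 / C * real (card V) powr (1 - \<epsilon>)"
    if G: "complete_cyl_graph V E" "monotone_cyl_graph V E" "simple_cyl_graph V E" "card V \<ge> 2" for V E
  proof -
    interpret monotone_drawing V E using G by unfold_locales
    define n where "n = real (card V)"
    have n: "n \<ge> 2" using G(4) unfolding n_def by simp
    define j where "j = nat \<lceil>log 2 n\<rceil>"
    have "log 2 n \<ge> 0" using n by simp
    then have j: "log 2 n \<le> real j" "real j \<le> log 2 n + 1" unfolding j_def by linarith+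
    have "n = 2 powr log 2 n" using n by simp
    also have "\<dots> \<le> 2 powr real j" using j(1) by (intro powr_mono) auto
    finally have "real (card V) \<le> real (2 ^ j)" unfolding n_def by (simp add: powr_realpow)
    then have "card V \<le> 2 ^ j" by (simp only: of_nat_le_iff)
    then obtain M where M: "M \<subseteq> cedges V" "\<forall>e\<in>M. \<forall>f\<in>M. e \<noteq> f \<longrightarrow> E e \<inter> E f = {}"
      "card V \<le> (2 * j + 3) * card M"
      using disjoint_edges_log G(4) by blast
    have "1 \<le> n powr \<epsilon>" using n assms by (intro ge_one_powr_ge_zero) auto
    \<comment> \<open>This is \<open>ln x \<le> x - 1\<close> at
      \<open>x = n powr \<epsilon>\<close>.\<close>
    moreover have "\<epsilon> * ln n \<le> n powr \<epsilon>"
      using ln_le_minus_one[of "n powr \<epsilon>"] n by (simp add: ln_powr)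
    then have "ln n \<le> n powr \<epsilon> / \<epsilon>" using assms by (simp add: field_simps)
    moreover have "log 2 n \<le> 2 * ln n"
    proof -
      have "ln 2 \<ge> (1 / 2 :: real)" using ln_le_minus_one[of "1 / 2"] by (simp add: ln_div)
      then have "ln n \<le> 2 * ln n * ln 2" using n mult_left_mono[of "1/2" "ln 2" "2 * ln n"] by simp
      then show ?thesis unfolding log_def by (simp add: divide_le_eq)
    qed
    moreover have "C * n powr \<epsilon> = 5 * n powr \<epsilon> + 4 * (n powr \<epsilon> / \<epsilon>)"
      unfolding C_def by (simp add: distrib_right)
    ultimately have bound: "2 * real j + 3 \<le> C * n powr \<epsilon>"
      using j(2) by linarith
    have "n = n powr (1 - \<epsilon>) * n powr \<epsilon>" using n by (simp flip: powr_add)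
    moreover have "n \<le> (2 * real j + 3) * real (card M)"
      using M(3) unfolding n_def by (metis (mono_tags) of_nat_add of_nat_le_iff of_nat_mult of_nat_numeral)
    then have "n \<le> C * n powr \<epsilon> * real (card M)"
      using mult_right_mono[OF bound, of "real (card M)"] by linarith
    ultimately have "n powr (1 - \<epsilon>) * n powr \<epsilon> \<le> (C * real (card M)) * n powr \<epsilon>" by (simp add: mult_ac)
    then have "n powr (1 - \<epsilon>) \<le> C * real (card M)" using n by (simp add: mult_le_cancel_right)
    then have "1 / C * n powr (1 - \<epsilon>) \<le> real (card M)" using C by (simp add: field_simps)
    then show ?thesis using M(1,2) unfolding n_def by blast
  qed
  show ?thesis using C main by (intro exI[of _ "1 / C"]) auto
qed

end
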